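(* Let $\mathcal{F}$ be a class of graphs. The following four statements are equivalent: (i) $\mathcal{F}$ is linearly $\sigma$-bounded, i.e. $\sup \chi(\Sigma)/\rho(\Sigma) < \infty$, where the supremum is over all $G \in \mathcal{F}$ and all neighborhood systems $\Sigma$ for $G$ with $\rho(\Sigma)\ge 1$; (ii) $\mathcal{F}$ is $\sigma$-bounded, i.e. there is a function $f$ such that every $G\in\mathcal{F}$ and every neighborhood system $\Sigma$ for $G$ satisfy $\chi(\Sigma)\le f(\rho(\Sigma))$; (iii) the supremum of $\chi(\Sigma)$ over all $G\in\mathcal{F}$ and all neighborhood systems $\Sigma$ for $G$ with $\rho(\Sigma)=2$ is finite; (iv) $\mathcal{F}$ has bounded star chromatic number, i.e. $\sup_{G\in\mathcal{F}}\chi_s(G)<\infty$.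
   Context: Graphs are finite, simple and undirected. For a graph $G=(V,E)$, a neighborhood system for $G$ is a collection $\Sigma=(\Sigma(v))_{v\in V}$ with $\Sigma(v)\subseteq N(v)$ for each $v$, where $N(v)$ is the set of neighbors of $v$. A $\Sigma$-coloring is an assignment of colors to the vertices so that any two distinct vertices that both belong to some common set $\Sigma(w)$ receive different colors (it need not be a proper coloring of $G$). $\chi(\Sigma)$ is the minimum number of colors in a $\Sigma$-coloring, and $\rho(\Sigma)=\max_{v\in V}|\Sigma(v)|$. A star coloring of $G$ is a proper vertex coloring such that every two color classes induce a forest of stars (equivalently, no path on four vertices is 2-colored); $\chi_s(G)$, the star chromatic number, is the least number of colors in a star coloring of $G$. *)

theory Defs
  imports Complex_Main "Graph_Theory.Graph_Theory"
begin

text \<open>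
  A finite simple undirected graph is a \<^locale>\<open>pair_graph\<close>: a finite, loopfree, symmetric
  set of arcs on a finite vertex set, an edge being a pair of opposite arcs.
\<close>

definition neighbors :: "'a pair_pre_digraph \<Rightarrow> 'a \<Rightarrow> 'a set" where
  "neighbors G v = {u. (v, u) \<in> parcs G}"

text \<open>Values of a neighborhood system outside the vertex set are never inspected.\<close>

definition neighborhood_system :: "'a pair_pre_digraph \<Rightarrow> ('a \<Rightarrow> 'a set) \<Rightarrow> bool" where
  "neighborhood_system G S \<longleftrightarrow> (\<forall>v\<in>pverts G. S v \<subseteq> neighbors G v)"

definition sigma_coloring :: "'a pair_pre_digraph \<Rightarrow> ('a \<Rightarrow> 'a set) \<Rightarrow> ('a \<Rightarrow> nat) \<Rightarrow> bool" where
  "sigma_coloring G S c \<longleftrightarrow>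
    (\<forall>w\<in>pverts G. \<forall>u\<in>S w. \<forall>v\<in>S w. u \<noteq> v \<longrightarrow> c u \<noteq> c v)"

definition chi_sigma :: "'a pair_pre_digraph \<Rightarrow> ('a \<Rightarrow> 'a set) \<Rightarrow> nat" where
  "chi_sigma G S = (LEAST k. \<exists>c. sigma_coloring G S c \<and> card (c ` pverts G) = k)"

text \<open>The inserted \<open>0\<close> only matters for the graph without vertices.\<close>

definition rho_sigma :: "'a pair_pre_digraph \<Rightarrow> ('a \<Rightarrow> 'a set) \<Rightarrow> nat" where
  "rho_sigma G S = Max (insert 0 ((\<lambda>v. card (S v)) ` pverts G))"

definition proper_coloring :: "'a pair_pre_digraph \<Rightarrow> ('a \<Rightarrow> nat) \<Rightarrow> bool" where
  "proper_coloring G c \<longleftrightarrow> (\<forall>(u, v)\<in>parcs G. c u \<noteq> c v)"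

text \<open>A star is some \<open>K\<^bsub>1,m\<^esub>\<close> with \<open>m \<ge> 0\<close>; in particular an isolated vertex is a star.\<close>

definition star :: "('a, 'b) pre_digraph \<Rightarrow> bool" where
  "star H \<longleftrightarrow> (\<exists>s\<in>verts H.
     arcs_ends H = {s} \<times> (verts H - {s}) \<union> (verts H - {s}) \<times> {s})"

text \<open>In a symmetric digraph the strongly connected components are the connected components.\<close>

definition star_forest :: "('a, 'b) pre_digraph \<Rightarrow> bool" where
  "star_forest H \<longleftrightarrow> (\<forall>C\<in>pre_digraph.sccs H. star C)"

definition star_coloring :: "'a pair_pre_digraph \<Rightarrow> ('a \<Rightarrow> nat) \<Rightarrow> bool" where
  "star_coloring G c \<longleftrightarrow> proper_coloring G c \<and>
    (\<forall>i j. star_forest (with_proj G \<restriction> {v \<in> pverts G. c v = i \<or> c v = j}))"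

definition star_chromatic_number :: "'a pair_pre_digraph \<Rightarrow> nat" where
  "star_chromatic_number G = (LEAST k. \<exists>c. star_coloring G c \<and> card (c ` pverts G) = k)"

definition linearly_sigma_bounded :: "'a pair_pre_digraph set \<Rightarrow> bool" where
  "linearly_sigma_bounded F \<longleftrightarrow>
    bdd_above {real (chi_sigma G S) / real (rho_sigma G S) | G S.
      G \<in> F \<and> neighborhood_system G S \<and> rho_sigma G S \<ge> 1}"

definition sigma_bounded :: "'a pair_pre_digraph set \<Rightarrow> bool" where
  "sigma_bounded F \<longleftrightarrow>
    (\<exists>f :: nat \<Rightarrow> nat. \<forall>G\<in>F. \<forall>S. neighborhood_system G S \<longrightarrow>
      chi_sigma G S \<le> f (rho_sigma G S))"

end

theory Submission
  imports Defs
begin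

text \<open>
  The chain is (i) \<open>\<Longrightarrow>\<close> (ii) \<open>\<Longrightarrow>\<close> (iii) \<open>\<Longrightarrow>\<close> (iv) \<open>\<Longrightarrow>\<close> (i), the last two steps being the substantial ones.

  (iii) \<open>\<Longrightarrow>\<close> (iv): Suppose that all systems of sets of size at most 2 have \<open>\<Sigma>\<close>-colourings with \<open>K\<close> colours.
  If every vertex of a set \<open>X\<close> had many neighbours in \<open>X\<close>, half of the vertices of \<open>X\<close> would have
  at least \<open>K + 1\<close> neighbours in some small \<open>A \<subseteq> X\<close>. Choosing a pair of neighbours in \<open>A\<close> for
  one such vertex after the other, each time so as to rule out a constant fraction of the surviving
  colourings of \<open>A\<close>, rules out all \<open>K ^ |A|\<close> of them, a contradiction. So the graph is degenerate, and a
  degenerate orientation together with \<open>\<Sigma>\<close>-colourings of pairs of out-neighbours yields a star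
  colouring.

  (iv) \<open>\<Longrightarrow>\<close> (i): In a star colouring with \<open>k\<close> colours, a vertex lies together with another vertex of its
  own colour in \<open>\<Sigma>(w)\<close> for at most one \<open>w\<close> of each colour, so the conflict graph on a colour class has
  degree at most \<open>k \<rho>(\<Sigma>)\<close>.
\<close>

section \<open>Degenerate relations, hitting sets and recolouring\<close>

lemma finite_has_maximizer:
  fixes f :: "'a \<Rightarrow> 'b :: linorder"
  assumes "finite S" "S \<noteq> {}"
  shows "\<exists>m\<in>S. \<forall>x\<in>S. f x \<le> f m"
proof -
  have fin: "finite (f ` S)" using assms(1) by simp
  then have "Max (f ` S) \<in> f ` S" using assms(2) by (intro Max_in) auto
  then obtain m where m: "m \<in> S" "Max (f ` S) = f m" by blast
  have "f x \<le> f m" if "x \<in> S" for x using Max_ge[OF fin, of "f x"] that m(2) by simp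
  then show ?thesis using m(1) by blast
qed

text \<open>Induction removes a vertex \<open>v\<close> with at most \<open>d\<close> neighbours and
  ranks it last. Then all neighbours of \<open>v\<close> precede it, and the sets counted for the
  other vertices do not change.\<close>

lemma degenerate_ordering:
  fixes V :: "'a set"
  assumes "finite V"
    and "\<And>X. X \<subseteq> V \<Longrightarrow> X \<noteq> {} \<Longrightarrow> \<exists>v\<in>X. card {u\<in>X. u \<noteq> v \<and> E v u} \<le> d"
  shows "\<exists>r :: 'a \<Rightarrow> nat. inj_on r V \<and> (\<forall>v\<in>V. card {u\<in>V. E v u \<and> r u < r v} \<le> d)"
  using assms
proof (induction V rule: finite_psubset_induct)
  case (psubset V)
  show ?case
  proof (cases "V = {}")
    case False
    then obtain v where v: "v \<in> V" "card {u\<in>V. u \<noteq> v \<and> E v u} \<le> d"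
      using psubset.prems by blast
    define W where "W = V - {v}"
    have W: "W \<subset> V" "finite W" "V = insert v W" "v \<notin> W"
      using v psubset.hyps unfolding W_def by auto
    obtain r :: "'a \<Rightarrow> nat" where r: "inj_on r W" "\<forall>w\<in>W. card {u\<in>W. E w u \<and> r u < r w} \<le> d"
      using psubset.IH[OF W(1)] psubset.prems W(1) by (meson order_trans psubset_imp_subset)
    \<comment> \<open>The inserted \<open>0\<close> keeps \<open>Max\<close> meaningful when
      \<open>W\<close> is empty.\<close>
    define r' where "r' = r(v := Suc (Max (insert 0 (r ` W))))"
    have le: "r u < r' v" if "u \<in> W" for u
    proof -
      have "r u \<le> Max (insert 0 (r ` W))"
        using that W(2) by (intro Max_ge) auto
      then show ?thesis by (simp add: r'_def)
    qed
    have eq: "r' u = r u" if "u \<in> W" for u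
      using that W(4) by (auto simp: r'_def)
    have "inj_on r' W" using r(1) inj_on_cong[of W r' r] eq by simp
    moreover have "r' v \<noteq> r' u" if "u \<in> W" for u using le[OF that] eq[OF that] by simp
    ultimately have "inj_on r' V" using W(4) by (auto simp: W(3) inj_on_insert)
    moreover have "card {u\<in>V. E w u \<and> r' u < r' w} \<le> d" if "w \<in> V" for w
    proof (cases "w = v")
      case True
      have "card {u\<in>V. E w u \<and> r' u < r' w} \<le> card {u\<in>V. u \<noteq> v \<and> E v u}"
        using True psubset.hyps(1) by (intro card_mono) auto
      then show ?thesis using v by simp
    next
      case False
      then have w: "w \<in> W" using that W by auto
      have "{u\<in>V. E w u \<and> r' u < r' w} = {u\<in>W. E w u \<and> r u < r w}"
        unfolding W(3) using eq w le by (auto dest: order.asym)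
      then show ?thesis using r w by simp
    qed
    ultimately show ?thesis by blast
  qed auto
qed

text \<open>Greedy colouring: a vertex with at most \<open>d\<close> neighbours is removed, the rest
  is coloured by induction, and one of the \<open>d + 1\<close> colours is free for the removed
  vertex. Symmetry lets conflicts with that vertex be checked in one direction only.\<close>

lemma degenerate_coloring:
  fixes V :: "'a set"
  assumes "finite V"
    and sym: "\<And>u v. u \<in> V \<Longrightarrow> v \<in> V \<Longrightarrow> E u v \<Longrightarrow> E v u"
    and "\<And>X. X \<subseteq> V \<Longrightarrow> X \<noteq> {} \<Longrightarrow> \<exists>v\<in>X. card {u\<in>X. u \<noteq> v \<and> E v u} \<le> d"
  shows "\<exists>c :: 'a \<Rightarrow> nat. c ` V \<subseteq> {..d} \<and> (\<forall>u\<in>V. \<forall>v\<in>V. u \<noteq> v \<and> E u v \<longrightarrow> c u \<noteq> c v)"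
  using assms
proof (induction V rule: finite_psubset_induct)
  case (psubset V)
  show ?case
  proof (cases "V = {}")
    case False
    then obtain v where v: "v \<in> V" "card {u\<in>V. u \<noteq> v \<and> E v u} \<le> d"
      using psubset.prems(2) by blast
    define W where "W = V - {v}"
    have W: "W \<subset> V" "finite W" "V = insert v W" "v \<notin> W"
      using v psubset.hyps unfolding W_def by auto
    have "\<exists>c :: 'a \<Rightarrow> nat. c ` W \<subseteq> {..d} \<and> (\<forall>u\<in>W. \<forall>v\<in>W. u \<noteq> v \<and> E u v \<longrightarrow> c u \<noteq> c v)"
      using W(1) by (intro psubset.IH) (auto intro!: psubset.prems)
    then obtain c :: "'a \<Rightarrow> nat" where c: "c ` W \<subseteq> {..d}"
      "\<And>u v. u \<in> W \<Longrightarrow> v \<in> W \<Longrightarrow> u \<noteq> v \<Longrightarrow> E u v \<Longrightarrow> c u \<noteq> c v"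
      by blast
    have "card (c ` {u\<in>V. u \<noteq> v \<and> E v u}) \<le> d"
      using v(2) psubset.hyps(1) by (intro order_trans[OF card_image_le]) auto
    then have "\<not> {..d} \<subseteq> c ` {u\<in>V. u \<noteq> v \<and> E v u}"
      using psubset.hyps(1) card_mono[of "c ` {u\<in>V. u \<noteq> v \<and> E v u}" "{..d}"] by auto
    then obtain i where i: "i \<le> d" "i \<notin> c ` {u\<in>V. u \<noteq> v \<and> E v u}" by auto
    have "(c(v := i)) ` V \<subseteq> {..d}" using c(1) i(1) W(3) by auto
    moreover have "(c(v := i)) u \<noteq> (c(v := i)) w" if "u \<in> V" "w \<in> V" "u \<noteq> w" "E u w" for u w
      using that c(2)[of u w] i(2) W psubset.prems(1)[of u w] by auto
    ultimately show ?thesis by blast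
  qed auto
qed

text \<open>Take the set \<open>A\<close> maximising \<open>2 \<Phi>(A) - (D - t) |A|\<close>, where \<open>\<Phi>(A)\<close> sums \<open>min t |N b \<inter> A|\<close>
  over \<open>b \<in> X\<close>: comparing with the empty set bounds \<open>|A|\<close>, and comparing with the sets
  \<open>insert a A\<close> bounds the number of \<open>b\<close> that see fewer than \<open>t\<close> elements of \<open>A\<close>.\<close>

lemma small_multihitting_set:
  fixes N :: "'a \<Rightarrow> 'a set"
  assumes fin: "finite X" and t: "t < D"
    and N: "\<And>b. b \<in> X \<Longrightarrow> N b \<subseteq> X" "\<And>b. b \<in> X \<Longrightarrow> D \<le> card (N b)"
  shows "\<exists>A\<subseteq>X. (D - t) * card A \<le> 2 * t * card X
    \<and> card X \<le> 2 * card {b\<in>X. t \<le> card (N b \<inter> A)}"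
proof -
  define \<Phi> where "\<Phi> A = (\<Sum>b\<in>X. min t (card (N b \<inter> A)))" for A
  define g where "g A = 2 * int (\<Phi> A) - int (D - t) * int (card A)" for A
  have finN: "finite (N b)" if "b \<in> X" for b
    using N(1)[OF that] fin finite_subset by blast
  have "finite (Pow X)" "Pow X \<noteq> {}" using fin by auto
  then obtain A where A: "A \<in> Pow X" "\<And>B. B \<in> Pow X \<Longrightarrow> g B \<le> g A"
    using finite_has_maximizer[of "Pow X" g] by blast
  have finA: "finite A" using A(1) fin finite_subset by auto
  have "g {} \<le> g A" using A by auto
  then have "int (D - t) * int (card A) \<le> 2 * int (\<Phi> A)"
    by (simp add: g_def \<Phi>_def)
  then have "(D - t) * card A \<le> 2 * \<Phi> A"
    by (metis (mono_tags, opaque_lifting) of_nat_le_iff of_nat_mult of_nat_numeral)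
  moreover have "\<Phi> A \<le> t * card X"
    unfolding \<Phi>_def using sum_bounded_above[of X "\<lambda>b. min t (card (N b \<inter> A))" t] by (simp add: mult.commute)
  ultimately have 1: "(D - t) * card A \<le> 2 * t * card X" by linarith
  define U where "U = {b\<in>X. card (N b \<inter> A) < t}"
  have finU: "finite U" "U \<subseteq> X" using fin by (auto simp: U_def)
  \<comment> \<open>Adding \<open>a\<close> raises \<open>\<Phi> A\<close> by one for each
    \<open>b\<close> in \<open>U\<close> that sees \<open>a\<close> and costs \<open>D - t\<close>;
    since \<open>A\<close> is a maximiser, the doubled gain cannot exceed the cost.\<close>
  have gain: "2 * card {b\<in>U. a \<in> N b} \<le> D - t" if a: "a \<in> X - A" for a
  proof -
    have min_eq: "min t (card (N b \<inter> insert a A)) = min t (card (N b \<inter> A)) + (if b \<in> {b\<in>U. a \<in> N b} then 1 else 0)"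
      if b: "b \<in> X" for b
      using a b finA by (auto simp: U_def Int_insert_right)
    have "\<Phi> (insert a A) = \<Phi> A + card ({b\<in>X. b \<in> {b\<in>U. a \<in> N b}})"
      unfolding \<Phi>_def using fin
      by (simp add: min_eq sum.distrib sum.If_cases cong: sum.cong) (simp add: Int_def)
    moreover have "{b\<in>X. b \<in> {b\<in>U. a \<in> N b}} = {b\<in>U. a \<in> N b}" using finU by auto
    moreover have "g (insert a A) \<le> g A" using A a by auto
    moreover have "card (insert a A) = Suc (card A)" using a finA by auto
    ultimately show ?thesis by (simp add: g_def algebra_simps)
  qed
  \<comment> \<open>Double counting of the pairs \<open>a \<in> N b\<close> with \<open>b\<close> in
    \<open>U\<close> and \<open>a\<close> in \<open>X - A\<close>: each \<open>b\<close> has at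
    least \<open>D - t\<close> such \<open>a\<close>, while \<open>gain\<close> bounds the number of
    \<open>b\<close> for each \<open>a\<close>.\<close>
  have "2 * (card U * (D - t)) \<le> 2 * (\<Sum>b\<in>U. card (N b - A))"
  proof -
    have "D - t \<le> card (N b - A)" if "b \<in> U" for b
    proof -
      have b: "b \<in> X" "card (N b \<inter> A) < t" using that by (auto simp: U_def)
      have "card (N b) = card (N b \<inter> A) + card (N b - A)"
        using finN[OF b(1)] by (simp add: card_Diff_subset_Int card_mono)
      then show ?thesis using N(2)[OF b(1)] b(2) by linarith
    qed
    then show ?thesis using sum_bounded_below[of U "D - t" "\<lambda>b. card (N b - A)"] by simp
  qed
  also have "(\<Sum>b\<in>U. card (N b - A)) = (\<Sum>b\<in>U. \<Sum>a\<in>X-A. if a \<in> N b then 1 else 0)"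
  proof (intro sum.cong refl)
    fix b assume "b \<in> U"
    then have "N b \<subseteq> X" using N finU by auto
    then have "N b - A = (X - A) \<inter> {a. a \<in> N b}" by auto
    then show "card (N b - A) = (\<Sum>a\<in>X-A. if a \<in> N b then 1 else 0)"
      using fin by (simp add: sum.If_cases)
  qed
  also have "\<dots> = (\<Sum>a\<in>X-A. card {b\<in>U. a \<in> N b})"
    using finU by (subst sum.swap) (simp add: sum.If_cases Int_def)
  also have "2 * \<dots> = (\<Sum>a\<in>X-A. 2 * card {b\<in>U. a \<in> N b})" by (simp add: sum_distrib_left)
  also have "\<dots> \<le> card (X - A) * (D - t)"
    using sum_bounded_above[of "X - A" "\<lambda>a. 2 * card {b\<in>U. a \<in> N b}" "D - t"] gain by simp
  also have "\<dots> \<le> card X * (D - t)"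
    using fin by (intro mult_right_mono card_mono) auto
  finally have "(2 * card U) * (D - t) \<le> card X * (D - t)" by (simp only: mult.assoc)
  then have U: "2 * card U \<le> card X" using t by simp
  have "{b\<in>X. t \<le> card (N b \<inter> A)} = X - U" by (auto simp: U_def)
  then have "card {b\<in>X. t \<le> card (N b \<inter> A)} = card X - card U"
    using finU by (simp add: card_Diff_subset)
  then show ?thesis using A(1) 1 U by auto
qed

text \<open>By the pigeonhole principle every colouring repeats a colour on the \<open>K + 1\<close>
  elements of \<open>T\<close>, so it fails to be injective on some pair. Averaging over all pairs
  gives one pair that eliminates at least the fraction \<open>1 / (Suc K choose 2)\<close> of the
  colourings.\<close>

lemma pair_killing_colorings:
  fixes \<Phi> :: "('a \<Rightarrow> nat) set"
  assumes fin: "finite \<Phi>" and range: "\<And>\<phi>. \<phi> \<in> \<Phi> \<Longrightarrow> \<phi> ` T \<subseteq> {..<K}"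
    and T: "card T = Suc K" and K: "0 < K"
  shows "\<exists>e\<subseteq>T. card e = 2 \<and>
    real (card {\<phi>\<in>\<Phi>. inj_on \<phi> e}) \<le> (1 - 1 / real (Suc K choose 2)) * real (card \<Phi>)"
proof -
  define P where "P = {e. e \<subseteq> T \<and> card e = 2}"
  have finT: "finite T" using T card.infinite by fastforce
  have P: "finite P" "card P = Suc K choose 2"
    unfolding P_def using finT n_subsets[OF finT, of 2] T by auto
  have q: "0 < Suc K choose 2" using K by (simp add: zero_less_binomial)
  have kill: "1 \<le> card {e\<in>P. \<not> inj_on \<phi> e}" if "\<phi> \<in> \<Phi>" for \<phi>
  proof -
    have "\<not> inj_on \<phi> T"
      using card_inj_on_le[of \<phi> T "{..<K}"] range[OF that] T by auto
    then obtain x y where "x \<in> T" "y \<in> T" "x \<noteq> y" "\<phi> x = \<phi> y" by (auto simp: inj_on_def)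
    then have "{x, y} \<in> {e\<in>P. \<not> inj_on \<phi> e}" by (auto simp: P_def inj_on_def)
    moreover have "finite {e\<in>P. \<not> inj_on \<phi> e}" using P by simp
    ultimately show ?thesis by (metis One_nat_def Suc_leI card_gt_0_iff empty_iff)
  qed
  have "real (card \<Phi>) \<le> (\<Sum>\<phi>\<in>\<Phi>. real (card {e\<in>P. \<not> inj_on \<phi> e}))"
    using sum_bounded_below[of \<Phi> 1 "\<lambda>\<phi>. real (card {e\<in>P. \<not> inj_on \<phi> e})"] kill by simp
  also have "\<dots> = (\<Sum>\<phi>\<in>\<Phi>. \<Sum>e\<in>P. if \<not> inj_on \<phi> e then 1 else 0)"
    using P by (simp add: sum.If_cases Int_def)
  also have "\<dots> = (\<Sum>e\<in>P. real (card {\<phi>\<in>\<Phi>. \<not> inj_on \<phi> e}))"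
    using fin by (subst sum.swap) (simp add: sum.If_cases Int_def)
  finally have sum_le: "real (card \<Phi>) \<le> (\<Sum>e\<in>P. real (card {\<phi>\<in>\<Phi>. \<not> inj_on \<phi> e}))" .
  have "\<exists>e\<in>P. real (card \<Phi>) / real (Suc K choose 2) \<le> real (card {\<phi>\<in>\<Phi>. \<not> inj_on \<phi> e})"
  proof (rule ccontr)
    assume "\<not> ?thesis"
    then have "(\<Sum>e\<in>P. real (card {\<phi>\<in>\<Phi>. \<not> inj_on \<phi> e})) < (\<Sum>e\<in>P. real (card \<Phi>) / real (Suc K choose 2))"
      using P q by (intro sum_strict_mono) (auto simp: not_le)
    also have "\<dots> = real (card \<Phi>)" using P q by simp
    finally show False using sum_le by simp
  qed
  then obtain e where e: "e \<in> P"
    "real (card \<Phi>) / real (Suc K choose 2) \<le> real (card {\<phi>\<in>\<Phi>. \<not> inj_on \<phi> e})" by blast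
  have "\<Phi> = {\<phi>\<in>\<Phi>. inj_on \<phi> e} \<union> {\<phi>\<in>\<Phi>. \<not> inj_on \<phi> e}" by auto
  then have "card \<Phi> = card {\<phi>\<in>\<Phi>. inj_on \<phi> e} + card {\<phi>\<in>\<Phi>. \<not> inj_on \<phi> e}"
    using fin by (subst card_Un_disjoint[symmetric]) auto
  then have "real (card {\<phi>\<in>\<Phi>. inj_on \<phi> e}) \<le> (1 - 1 / real (Suc K choose 2)) * real (card \<Phi>)"
    using e(2) by (simp add: algebra_simps add_divide_distrib)
  then show ?thesis using e(1) unfolding P_def by blast
qed

text \<open>The pairs are chosen one after the other, each against the colourings that have survived
  the earlier ones, so that the surviving fractions multiply.\<close>

lemma pairs_killing_colorings:
  fixes \<Phi> :: "('a \<Rightarrow> nat) set"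
  assumes "finite B" and fin: "finite \<Phi>" and K: "0 < K"
    and "\<And>b. b \<in> B \<Longrightarrow> card (T b) = Suc K"
    and "\<And>\<phi> b. \<phi> \<in> \<Phi> \<Longrightarrow> b \<in> B \<Longrightarrow> \<phi> ` T b \<subseteq> {..<K}"
  shows "\<exists>S. (\<forall>b\<in>B. S b \<subseteq> T b \<and> card (S b) = 2) \<and>
    real (card {\<phi>\<in>\<Phi>. \<forall>b\<in>B. inj_on \<phi> (S b)})
      \<le> (1 - 1 / real (Suc K choose 2)) ^ card B * real (card \<Phi>)"
  using assms(1,4,5)
proof (induction B rule: finite_induct)
  case (insert b B)
  let ?q = "1 - 1 / real (Suc K choose 2)"
  obtain S where S: "\<forall>b\<in>B. S b \<subseteq> T b \<and> card (S b) = 2"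
    "real (card {\<phi>\<in>\<Phi>. \<forall>b\<in>B. inj_on \<phi> (S b)}) \<le> ?q ^ card B * real (card \<Phi>)"
    using insert.IH[OF insert.prems(1)[OF insertI2] insert.prems(2)[OF _ insertI2]] by blast
  let ?\<Psi> = "{\<phi>\<in>\<Phi>. \<forall>b\<in>B. inj_on \<phi> (S b)}"
  obtain e where e: "e \<subseteq> T b" "card e = 2"
    "real (card {\<phi>\<in>?\<Psi>. inj_on \<phi> e}) \<le> ?q * real (card ?\<Psi>)"
    using pair_killing_colorings[of ?\<Psi> "T b" K] fin K insert.prems by auto
  define S' where "S' = S(b := e)"
  have "{\<phi>\<in>\<Phi>. \<forall>x\<in>insert b B. inj_on \<phi> (S' x)} = {\<phi>\<in>?\<Psi>. inj_on \<phi> e}"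
    using insert.hyps by (auto simp: S'_def)
  moreover have "0 < Suc K choose 2" using K by (simp add: zero_less_binomial)
  then have "1 \<le> real (Suc K choose 2)" by linarith
  then have "0 \<le> ?q" by (subst diff_ge_0_iff_ge, subst divide_le_eq_1_pos) linarith+
  then have "?q * real (card ?\<Psi>) \<le> ?q * (?q ^ card B * real (card \<Phi>))"
    using S(2) by (rule mult_left_mono[rotated])
  ultimately have "real (card {\<phi>\<in>\<Phi>. \<forall>x\<in>insert b B. inj_on \<phi> (S' x)})
      \<le> ?q ^ card (insert b B) * real (card \<Phi>)"
    using e(3) insert.hyps by (simp add: mult.assoc)
  moreover have "\<forall>x\<in>insert b B. S' x \<subseteq> T x \<and> card (S' x) = 2"
    using S(1) e by (auto simp: S'_def)
  ultimately show ?case by blast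
qed auto

text \<open>Only the partition into colour classes matters. This turns colourings by pairs or by
  functions into colourings by an initial segment of the naturals.\<close>

lemma nat_recoloring:
  assumes "finite V" "card (c ` V) \<le> k"
  shows "\<exists>c' :: 'a \<Rightarrow> nat. c' ` V \<subseteq> {..<k} \<and> (\<forall>u\<in>V. \<forall>v\<in>V. c' u = c' v \<longleftrightarrow> c u = c v)"
proof -
  obtain f where f: "inj_on f (c ` V)" "f ` (c ` V) \<subseteq> {..<k}"
    using assms inj_on_iff_card_le[of "c ` V" "{..<k}"] by auto
  then have "(f \<circ> c) ` V \<subseteq> {..<k}" "\<forall>u\<in>V. \<forall>v\<in>V. (f \<circ> c) u = (f \<circ> c) v \<longleftrightarrow> c u = c v"
    by (auto simp: image_subset_iff inj_on_def)
  then show ?thesis by blast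
qed

section \<open>Star colourings without bicoloured paths\<close>

lemma arcs_ends_induce_with_proj:
  "arcs_ends (with_proj G \<restriction> W) = {(u, v). (u, v) \<in> parcs G \<and> u \<in> W \<and> v \<in> W}"
  by (auto simp: arcs_ends_conv image_iff)

lemma arcs_ends_induce_induce_with_proj:
  "arcs_ends ((with_proj G \<restriction> W) \<restriction> S) = {(u, v). (u, v) \<in> parcs G \<and> u \<in> W \<inter> S \<and> v \<in> W \<inter> S}"
  by (auto simp: arcs_ends_conv image_iff)

context pair_graph
begin

text \<open>The centre of a component is a vertex \<open>s\<close> of maximal degree. The condition
  on paths forces every other vertex of the component to be adjacent to \<open>s\<close>, and the
  absence of triangles forbids edges between two neighbours of \<open>s\<close>.\<close>

lemma star_forest_induceI:
  assumes W: "W \<subseteq> pverts G"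
    and no_edge: "\<And>x y z. x \<in> W \<Longrightarrow> y \<in> W \<Longrightarrow> z \<in> W \<Longrightarrow>
      (x, y) \<in> parcs G \<Longrightarrow> (x, z) \<in> parcs G \<Longrightarrow> (y, z) \<notin> parcs G"
    and no_path: "\<And>x y z w. x \<in> W \<Longrightarrow> y \<in> W \<Longrightarrow> z \<in> W \<Longrightarrow> w \<in> W \<Longrightarrow>
      (x, y) \<in> parcs G \<Longrightarrow> (y, z) \<in> parcs G \<Longrightarrow> (z, w) \<in> parcs G \<Longrightarrow> x = z \<or> y = w"
  shows "star_forest (with_proj G \<restriction> W)"
  unfolding star_forest_def
proof
  fix C assume C: "C \<in> pre_digraph.sccs (with_proj G \<restriction> W)"
  interpret H: wf_digraph "with_proj G \<restriction> W"
    using W by (intro wellformed_induce_subgraph)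
  obtain S where S: "C = (with_proj G \<restriction> W) \<restriction> S" "S \<in> H.sccs_verts"
    using C H.sccs_conv_sccs_verts by auto
  have SW: "S \<subseteq> W" using H.sccs_verts_subsets[OF S(2)] by simp
  have finW: "finite W" using W pair_finite_verts finite_subset by blast
  define N where "N v = {u\<in>W. (v, u) \<in> parcs G}" for v
  have finN: "finite (N v)" for v using finW by (simp add: N_def)
  have "S \<noteq> {}" using S(2) by (simp add: H.in_sccs_verts_conv_reachable)
  moreover have "finite S" using SW finW finite_subset by auto
  ultimately obtain s where s: "s \<in> S" "\<And>v. v \<in> S \<Longrightarrow> card (N v) \<le> card (N s)"
    using finite_has_maximizer[of S "\<lambda>v. card (N v)"] by blast
  have "v = s \<or> v \<in> N s" if v: "v \<in> S" for v
  proof -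
    have "s \<rightarrow>\<^sup>*\<^bsub>with_proj G \<restriction> W\<^esub> v"
      using S(2) s(1) that by (simp add: H.in_sccs_verts_conv_reachable)
    then show ?thesis
    proof (induction rule: H.reachable_induct)
      case (step x y)
      then have xy: "(x, y) \<in> parcs G" "x \<in> W" "y \<in> W"
        by (auto simp: arcs_ends_induce_with_proj)
      show ?case
      proof (cases "x = s \<or> y = s")
        case True then show ?thesis using xy by (auto simp: N_def)
      next
        \<comment> \<open>Leaving a neighbour \<open>x\<close> of \<open>s\<close> towards
          \<open>y\<close> different from \<open>s\<close> makes \<open>x\<close> the only neighbour
          of \<open>s\<close>, since another one would start a forbidden path. But \<open>x\<close>
          has the two neighbours \<open>s\<close> and \<open>y\<close>, against the maximality of
          \<open>s\<close>.\<close>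
        case False
        then have x: "x \<in> N s" using step.IH by simp
        have sx: "(s, x) \<in> parcs G" "s \<in> W" using x s(1) SW by (auto simp: N_def)
        have "z = x" if "z \<in> N s" for z
          using no_path[of z s x y] that sx xy False arcs_symmetric[of s z] by (auto simp: N_def)
        then have "N s = {x}" using x by blast
        then have "card (N s) = 1" by simp
        have "s \<rightarrow>\<^sup>*\<^bsub>with_proj G \<restriction> W\<^esub> x" "x \<rightarrow>\<^sup>*\<^bsub>with_proj G \<restriction> W\<^esub> s"
          using sx xy arcs_symmetric[of s x]
          by (auto intro!: H.reachable_adjI simp: arcs_ends_induce_with_proj)
        then have "x \<in> S" using S(2) s(1) unfolding H.in_sccs_verts_conv_reachable by blast
        have "card {s, y} \<le> card (N x)"
          using finN sx xy arcs_symmetric[of s x] by (intro card_mono) (auto simp: N_def)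
        moreover have "s \<noteq> y" using False by blast
        ultimately have "2 \<le> card (N x)" by simp
        then show ?thesis using s(2)[OF \<open>x \<in> S\<close>] \<open>card (N s) = 1\<close> by simp
      qed
    qed simp
  qed
  then have adj: "(s, v) \<in> parcs G" "(v, s) \<in> parcs G" if "v \<in> S - {s}" for v
    using that arcs_symmetric by (auto simp: N_def)
  have "arcs_ends C = {s} \<times> (S - {s}) \<union> (S - {s}) \<times> {s}"
  proof (intro equalityI subsetI)
    fix e assume "e \<in> arcs_ends C"
    then obtain u v where e: "e = (u, v)" "(u, v) \<in> parcs G" "u \<in> S" "v \<in> S"
      unfolding S(1) arcs_ends_induce_induce_with_proj by auto
    have "u \<noteq> v" using e(2) no_loops' by blast
    moreover have "u = s \<or> v = s"
      using no_edge[of s u v] adj(1)[of u] adj(1)[of v] e s(1) SW by auto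
    ultimately show "e \<in> {s} \<times> (S - {s}) \<union> (S - {s}) \<times> {s}" using e by auto
  next
    fix e assume "e \<in> {s} \<times> (S - {s}) \<union> (S - {s}) \<times> {s}"
    then show "e \<in> arcs_ends C"
      unfolding S(1) arcs_ends_induce_induce_with_proj using adj s(1) SW by auto
  qed
  then show "star C" using s(1) by (auto simp: star_def S(1))
qed

text \<open>The walk stays inside one component, which is a star. Each arc of a star has the centre
  as exactly one of its ends, so the centre is every second vertex of the walk.\<close>

lemma star_forest_induceD:
  assumes W: "W \<subseteq> pverts G" "star_forest (with_proj G \<restriction> W)"
    and V: "x \<in> W" "y \<in> W" "z \<in> W" "w \<in> W"
    and E: "(x, y) \<in> parcs G" "(y, z) \<in> parcs G" "(z, w) \<in> parcs G"
    and "x \<noteq> w"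
  shows "x = z \<or> y = w"
proof -
  interpret H: wf_digraph "with_proj G \<restriction> W"
    using W(1) by (intro wellformed_induce_subgraph)
  define S where "S = H.scc_of x"
  have adj: "u \<rightarrow>\<^sup>*\<^bsub>with_proj G \<restriction> W\<^esub> v \<and> v \<rightarrow>\<^sup>*\<^bsub>with_proj G \<restriction> W\<^esub> u"
    if "(u, v) \<in> parcs G" "u \<in> W" "v \<in> W" for u v
    using that arcs_symmetric[of u v]
    by (auto intro!: H.reachable_adjI simp: arcs_ends_induce_with_proj)
  have S: "x \<in> S" "y \<in> S" "z \<in> S" "w \<in> S"
    using adj[OF E(1)] adj[OF E(2)] adj[OF E(3)] V
    unfolding S_def H.scc_of_def by (auto intro: H.reachable_trans)
  have "S \<in> H.sccs_verts" unfolding S_def using V(1) by (intro H.scc_of_in_sccs_verts) simp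
  then have "(with_proj G \<restriction> W) \<restriction> S \<in> H.sccs" by (rule H.in_verts_sccsD_sccs)
  then have "star ((with_proj G \<restriction> W) \<restriction> S)" using W(2) by (simp add: star_forest_def)
  then obtain s where s: "arcs_ends ((with_proj G \<restriction> W) \<restriction> S) = {s} \<times> (S - {s}) \<union> (S - {s}) \<times> {s}"
    by (auto simp: star_def)
  have "(x, y) \<in> arcs_ends ((with_proj G \<restriction> W) \<restriction> S)" "(y, z) \<in> arcs_ends ((with_proj G \<restriction> W) \<restriction> S)"
    "(z, w) \<in> arcs_ends ((with_proj G \<restriction> W) \<restriction> S)"
    unfolding arcs_ends_induce_induce_with_proj using S V E by auto
  then show ?thesis unfolding s using \<open>x \<noteq> w\<close> by auto
qed

text \<open>This replaces components by a local condition, the only form in which star colourings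
  are used afterwards. Triangles need no separate condition, because a proper colouring gives them
  three colours.\<close>

lemma star_coloring_iff_no_bicolored_path:
  "star_coloring G c \<longleftrightarrow> proper_coloring G c \<and>
    (\<forall>x y z w. (x, y) \<in> parcs G \<and> (y, z) \<in> parcs G \<and> (z, w) \<in> parcs G \<and> c x = c z \<and> c y = c w
      \<longrightarrow> x = z \<or> y = w)" (is "_ \<longleftrightarrow> _ \<and> ?no_path")
proof
  assume c: "star_coloring G c"
  have "x = z \<or> y = w" if E: "(x, y) \<in> parcs G" "(y, z) \<in> parcs G" "(z, w) \<in> parcs G"
    and eq: "c x = c z" "c y = c w" for x y z w
  proof -
    have "c x \<noteq> c w" using c E(3) eq by (auto simp: star_coloring_def proper_coloring_def)
    then have "x \<noteq> w" by blast
    then show ?thesis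
      using c E[THEN in_arcsD1] E[THEN in_arcsD2] eq
      by (intro star_forest_induceD[OF _ _ _ _ _ _ E, of "{v \<in> pverts G. c v = c x \<or> c v = c y}"])
        (auto simp: star_coloring_def)
  qed
  then show "proper_coloring G c \<and> ?no_path" using c by (auto simp: star_coloring_def)
next
  assume c: "proper_coloring G c \<and> ?no_path"
  then have proper: "c u \<noteq> c v" if "(u, v) \<in> parcs G" for u v
    using that by (auto simp: proper_coloring_def)
  have "star_forest (with_proj G \<restriction> {v \<in> pverts G. c v = i \<or> c v = j})" for i j
  proof (rule star_forest_induceI, goal_cases)
    case (2 x y z)
    then show ?case using proper[of x y] proper[of x z] proper[of y z] by auto
  next
    case (3 x y z w)
    \<comment> \<open>Only the colours \<open>i\<close> and \<open>j\<close> are available and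
      adjacent vertices differ, so the colours alternate along the walk.\<close>
    then have "c x = c z" "c y = c w" using proper[of x y] proper[of y z] proper[of z w] by auto
    then show ?case using c 3 by blast
  qed auto
  then show "star_coloring G c" using c by (simp add: star_coloring_def)
qed

section \<open>Existence of optimal colourings and elementary bounds\<close>

lemma inj_coloring: "\<exists>c :: 'a \<Rightarrow> nat. inj_on c (pverts G)"
  using pair_finite_verts finite_imp_inj_to_nat_seg by blast

lemma inj_star_coloring:
  assumes "inj_on c (pverts G)"
  shows "star_coloring G c"
  unfolding star_coloring_iff_no_bicolored_path proper_coloring_def
  using assms by (auto dest: wellformed' no_loops' inj_onD[rotated])

lemma star_chromatic_number_le:
  assumes "star_coloring G c" "card (c ` pverts G) \<le> k"
  shows "star_chromatic_number G \<le> k"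
  unfolding star_chromatic_number_def using assms by (metis (mono_tags, lifting) Least_le order_trans)

lemma star_coloring_of_star_chromatic_number:
  "\<exists>c. star_coloring G c \<and> card (c ` pverts G) = star_chromatic_number G"
  unfolding star_chromatic_number_def using inj_coloring inj_star_coloring
  by (rule_tac LeastI_ex) blast

text \<open>Giving all vertices different colours meets every constraint, so the minimum in
  \<open>chi_sigma\<close> is attained.\<close>

lemma sigma_coloring_of_chi_sigma:
  assumes "neighborhood_system G S"
  shows "\<exists>c. sigma_coloring G S c \<and> card (c ` pverts G) = chi_sigma G S"
proof -
  obtain c :: "'a \<Rightarrow> nat" where "inj_on c (pverts G)" using inj_coloring by blast
  then have "sigma_coloring G S c"
    using assms unfolding sigma_coloring_def neighborhood_system_def neighbors_def
    by (auto dest: wellformed' inj_onD)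
  then show ?thesis
    unfolding chi_sigma_def by (rule_tac LeastI_ex) blast
qed

lemma chi_sigma_le:
  assumes "sigma_coloring G S c" "card (c ` pverts G) \<le> k"
  shows "chi_sigma G S \<le> k"
  unfolding chi_sigma_def using assms by (metis (mono_tags, lifting) Least_le order_trans)

lemma finite_neighbors: "finite (neighbors G v)"
  by (rule finite_subset[OF _ pair_finite_verts]) (auto simp: neighbors_def dest: wellformed')

lemma card_le_rho_sigma: "v \<in> pverts G \<Longrightarrow> card (S v) \<le> rho_sigma G S"
  unfolding rho_sigma_def using pair_finite_verts by (intro Max_ge) auto

lemma rho_sigma_le: "(\<And>v. v \<in> pverts G \<Longrightarrow> card (S v) \<le> k) \<Longrightarrow> rho_sigma G S \<le> k"
  unfolding rho_sigma_def using pair_finite_verts by (subst Max_le_iff) auto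

text \<open>Sets with at most one element impose no constraint, so one colour suffices. This settles
  the small values of \<open>rho_sigma\<close> about which conditions (i) and (iii) say
  nothing.\<close>

lemma chi_sigma_le_1:
  assumes S: "neighborhood_system G S" and "rho_sigma G S \<le> 1"
  shows "chi_sigma G S \<le> 1"
proof (rule chi_sigma_le[where c = "\<lambda>_. 0"])
  have "u = v" if "w \<in> pverts G" "u \<in> S w" "v \<in> S w" for u v w
  proof -
    have "finite (S w)" using S that(1) finite_neighbors finite_subset
      unfolding neighborhood_system_def by blast
    moreover have "card (S w) \<le> 1" using card_le_rho_sigma[OF that(1)] assms(2) order_trans by blast
    ultimately show ?thesis using that(2,3) card_le_Suc0_iff_eq by fastforce
  qed
  then show "sigma_coloring G S (\<lambda>_. 0)" by (auto simp: sigma_coloring_def)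
  show "card ((\<lambda>_. 0::nat) ` pverts G) \<le> 1"
    by (metis card.empty card.insert card_mono empty_iff finite.emptyI finite.insertI image_subsetI insertI1 One_nat_def)
qed

end

section \<open>Colouring systems of pairs\<close>

definition pair_systems_colorable :: "'a pair_pre_digraph \<Rightarrow> nat \<Rightarrow> bool" where
  "pair_systems_colorable G K \<longleftrightarrow>
    (\<forall>S. neighborhood_system G S \<and> (\<forall>v\<in>pverts G. card (S v) \<le> 2) \<longrightarrow>
      (\<exists>c. sigma_coloring G S c \<and> c ` pverts G \<subseteq> {..<K}))"

lemma pair_systems_colorable_degenerate:
  assumes K: "0 < K"
  shows "\<exists>D. \<forall>G :: 'a pair_pre_digraph. pair_graph G \<longrightarrow> pair_systems_colorable G K \<longrightarrow>
    (\<forall>X\<subseteq>pverts G. X \<noteq> {} \<longrightarrow> (\<exists>v\<in>X. card (neighbors G v \<inter> X) < D))"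
proof -
  define m where "m = real (Suc K choose 2)"
  define q where "q = 1 - 1 / m"
  have "0 < Suc K choose 2" using K by (simp add: zero_less_binomial)
  then have "1 \<le> m" unfolding m_def by linarith
  then have q: "0 \<le> q" "q < 1" by (simp_all add: q_def)
  then obtain M where M: "q ^ M < 1 / real K"
    using real_arch_pow_inv[of "1 / real K" q] K by auto
  \<comment> \<open>Each vertex of \<open>A\<close> multiplies the number of colourings by
    \<open>K\<close>; \<open>M\<close> chosen pairs per vertex of \<open>A\<close> outweigh this
    factor.\<close>
  have KM: "real K * q ^ M < 1" using M K by (simp add: field_simps)
  have "0 < M" using KM K by (cases M) auto
  \<comment> \<open>With \<open>t = Suc K\<close>, the bound
    \<open>(D - t) * card A \<le> 2 * t * card X\<close> becomes
    \<open>2 * M * card A \<le> card X\<close>. At least half of \<open>X\<close> lies in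
    \<open>B\<close>, whence \<open>M * card A \<le> card B\<close>.\<close>
  define D where "D = Suc K + 4 * Suc K * M"
  have "\<exists>v\<in>X. card (neighbors G v \<inter> X) < D"
    if G: "pair_graph G" "pair_systems_colorable G K" and X: "X \<subseteq> pverts G" "X \<noteq> {}"
    for G :: "'a pair_pre_digraph" and X
  proof (rule ccontr)
    interpret pair_graph G by fact
    assume "\<not> ?thesis"
    then have deg: "D \<le> card (neighbors G v \<inter> X)" if "v \<in> X" for v
      using that by (auto simp: not_less)
    have finX: "finite X" using X pair_finite_verts finite_subset by blast
    have "Suc K < D" using \<open>0 < M\<close> by (simp add: D_def)
    from small_multihitting_set[OF finX this, of "\<lambda>v. neighbors G v \<inter> X"] deg
    obtain A where A: "A \<subseteq> X" "(D - Suc K) * card A \<le> 2 * Suc K * card X"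
      "card X \<le> 2 * card {b\<in>X. Suc K \<le> card (neighbors G b \<inter> X \<inter> A)}"
      by auto
    define B where "B = {b\<in>X. Suc K \<le> card (neighbors G b \<inter> X \<inter> A)}"
    have finA: "finite A" and finB: "finite B" using A(1) finX finite_subset by (auto simp: B_def)
    have "2 * Suc K * (2 * M * card A) \<le> 2 * Suc K * card X"
      using A(2) by (simp add: D_def algebra_simps)
    then have "2 * M * card A \<le> card X" by (simp only: mult_le_cancel1) simp
    then have AB: "M * card A \<le> card B" using A(3) by (simp add: B_def)
    have "card X > 0" using X finX by (simp add: card_gt_0_iff)
    then have "card B > 0" using A(3) by (simp add: B_def)
    then obtain b where "b \<in> B" by (metis card.empty equals0I less_irrefl)
    then have "A \<noteq> {}" by (auto simp: B_def)
    then have A0: "0 < card A" using finA by (simp add: card_gt_0_iff)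
    have "\<exists>T. T \<subseteq> neighbors G b \<inter> A \<and> card T = Suc K" if "b \<in> B" for b
    proof -
      have "Suc K \<le> card (neighbors G b \<inter> A)"
        using that finA
        by (auto simp: B_def elim: order_trans intro!: card_mono)
      then show ?thesis using obtain_subset_with_card_n by metis
    qed
    then obtain T where T: "\<And>b. b \<in> B \<Longrightarrow> T b \<subseteq> neighbors G b \<inter> A" "\<And>b. b \<in> B \<Longrightarrow> card (T b) = Suc K"
      by metis
    define \<Phi> where "\<Phi> = (A \<rightarrow>\<^sub>E {..<K})"
    have \<Phi>: "finite \<Phi>" "card \<Phi> = K ^ card A"
      using finA by (auto simp: \<Phi>_def card_PiE intro: finite_PiE)
    have "\<exists>S. (\<forall>b\<in>B. S b \<subseteq> T b \<and> card (S b) = 2) \<and>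
      real (card {\<phi>\<in>\<Phi>. \<forall>b\<in>B. inj_on \<phi> (S b)})
        \<le> (1 - 1 / real (Suc K choose 2)) ^ card B * real (card \<Phi>)"
      using T by (intro pairs_killing_colorings finB \<Phi> K) (force simp: \<Phi>_def)+
    then obtain S where S: "\<forall>b\<in>B. S b \<subseteq> T b \<and> card (S b) = 2"
      "real (card {\<phi>\<in>\<Phi>. \<forall>b\<in>B. inj_on \<phi> (S b)}) \<le> q ^ card B * real (card \<Phi>)"
      unfolding q_def m_def by blast
    \<comment> \<open>Outside \<open>B\<close> the empty set imposes nothing, so this is a system of
      sets of size at most 2 on all of \<open>G\<close>.\<close>
    define S' where "S' v = (if v \<in> B then S v else {})" for v
    have "neighborhood_system G S'" "\<forall>v\<in>pverts G. card (S' v) \<le> 2"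
      using S(1) T(1) by (fastforce simp: neighborhood_system_def S'_def, simp add: S'_def)
    then obtain c where c: "sigma_coloring G S' c" "c ` pverts G \<subseteq> {..<K}"
      using G(2) unfolding pair_systems_colorable_def by blast
    \<comment> \<open>The colouring \<open>c\<close> restricts to an element of
      \<open>\<Phi>\<close> that survives every chosen pair, whereas the estimate leaves fewer than
      one survivor.\<close>
    have "restrict c A \<in> \<Phi>" using c(2) A(1) X(1) by (auto simp: \<Phi>_def)
    moreover have "inj_on (restrict c A) (S b)" if "b \<in> B" for b
    proof -
      have "S b \<subseteq> A" using that S(1) T(1) by blast
      have "b \<in> pverts G" using that X(1) by (auto simp: B_def)
      then have "inj_on c (S b)" using c(1) that unfolding sigma_coloring_def inj_on_def S'_def by metis
      then show ?thesis using \<open>S b \<subseteq> A\<close> by (auto simp: inj_on_def)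
    qed
    ultimately have "restrict c A \<in> {\<phi>\<in>\<Phi>. \<forall>b\<in>B. inj_on \<phi> (S b)}" by blast
    then have "0 < card {\<phi>\<in>\<Phi>. \<forall>b\<in>B. inj_on \<phi> (S b)}" using \<Phi>(1) by (auto simp: card_gt_0_iff)
    then have "1 \<le> q ^ card B * real (card \<Phi>)" using S(2) by linarith
    also have "\<dots> \<le> q ^ (M * card A) * real (card \<Phi>)"
      using q AB by (intro mult_right_mono power_decreasing) auto
    also have "\<dots> = (real K * q ^ M) ^ card A"
      by (simp add: \<Phi>(2) power_mult_distrib power_mult)
    also have "\<dots> < 1"
      using power_strict_mono[OF KM _ A0] q by simp
    finally show False by simp
  qed
  then show ?thesis by blast
qed

section \<open>Transfer between pair systems, star colourings and general systems\<close>

context pair_graph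
begin

text \<open>The elements of each \<open>S v\<close> are indexed by numbers below \<open>r\<close>.
  For every pair of indices, the elements with these indices form a system of pairs; the product of
  the \<open>r * r\<close> colourings separates any two elements of any \<open>S v\<close>.\<close>

lemma bounded_system_coloring:
  assumes K: "pair_systems_colorable G K" and S: "neighborhood_system G S"
    and r: "\<And>v. v \<in> pverts G \<Longrightarrow> card (S v) \<le> r"
  shows "\<exists>c :: 'a \<Rightarrow> nat. sigma_coloring G S c \<and> c ` pverts G \<subseteq> {..<K ^ (r * r)}"
proof -
  have S_sub: "S v \<subseteq> neighbors G v" if "v \<in> pverts G" for v
    using S that by (auto simp: neighborhood_system_def)
  have "\<exists>f. S v \<subseteq> f ` {..<r}" if v: "v \<in> pverts G" for v
  proof -
    obtain f where "bij_betw f {0..<card (S v)} (S v)"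
      using ex_bij_betw_nat_finite finite_subset[OF S_sub[OF v] finite_neighbors] by blast
    then have "S v = f ` {0..<card (S v)}" by (simp add: bij_betw_def)
    also have "\<dots> \<subseteq> f ` {..<r}" using r[OF v] by auto
    finally show ?thesis by blast
  qed
  then obtain f where f: "\<And>v. v \<in> pverts G \<Longrightarrow> S v \<subseteq> f v ` {..<r}" by metis
  \<comment> \<open>The enumeration \<open>f v\<close> may leave \<open>S v\<close> at indices
    beyond its size; the intersection discards such values.\<close>
  define P where "P i j v = {f v i, f v j} \<inter> S v" for i j :: nat and v
  have "\<exists>c. sigma_coloring G (P i j) c \<and> c ` pverts G \<subseteq> {..<K}" for i j
  proof -
    have "neighborhood_system G (P i j)" using S by (auto simp: P_def neighborhood_system_def)
    moreover have "card (P i j v) \<le> 2" for v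
    proof -
      have "card (P i j v) \<le> card {f v i, f v j}" unfolding P_def by (intro card_mono) auto
      also have "\<dots> \<le> 2" by (simp add: card_insert_if)
      finally show ?thesis .
    qed
    ultimately show ?thesis using K by (simp add: pair_systems_colorable_def)
  qed
  then obtain c where c: "\<And>i j. sigma_coloring G (P i j) (c i j)"
    "\<And>i j. c i j ` pverts G \<subseteq> {..<K}" by metis
  define I where "I = {..<r} \<times> {..<r}"
  define C where "C x = (\<lambda>(i, j)\<in>I. c i j x)" for x
  have "C ` pverts G \<subseteq> I \<rightarrow>\<^sub>E {..<K}"
    using c(2) by (fastforce simp: C_def)
  moreover have "finite I" "card I = r * r" by (simp_all add: I_def)
  ultimately have "card (C ` pverts G) \<le> K ^ (r * r)"
    using card_mono[of "I \<rightarrow>\<^sub>E {..<K}" "C ` pverts G"] by (auto simp: card_PiE intro: finite_PiE)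
  then obtain c' :: "'a \<Rightarrow> nat" where c': "c' ` pverts G \<subseteq> {..<K ^ (r * r)}"
    "\<forall>u\<in>pverts G. \<forall>v\<in>pverts G. c' u = c' v \<longleftrightarrow> C u = C v"
    using nat_recoloring[OF pair_finite_verts] by blast
  have "c' u \<noteq> c' v" if w: "w \<in> pverts G" "u \<in> S w" "v \<in> S w" "u \<noteq> v" for u v w
  proof -
    obtain i j where ij: "i < r" "j < r" "u = f w i" "v = f w j"
      using f[OF w(1)] w by blast
    then have "c i j u \<noteq> c i j v"
      using c(1)[of i j] w unfolding sigma_coloring_def P_def by blast
    then have "C u \<noteq> C v" using ij by (auto simp: C_def I_def fun_eq_iff)
    moreover have "u \<in> pverts G" "v \<in> pverts G"
      using S_sub[OF w(1)] w by (auto simp: neighbors_def dest: wellformed')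
    ultimately show ?thesis using c'(2) by blast
  qed
  then show ?thesis using c'(1) by (auto simp: sigma_coloring_def)
qed

text \<open>Orient the edges along a degenerate ordering. It suffices that the out-neighbours of a vertex
  get distinct colours, which is a \<open>\<Sigma>\<close>-colouring, and that every directed path \<open>x \<rightarrow> y \<rightarrow> z\<close> gets
  three colours, which a greedy colouring along the ordering achieves.\<close>

lemma star_chromatic_number_le_of_degenerate:
  assumes K: "pair_systems_colorable G K"
    and deg: "\<And>X. X \<subseteq> pverts G \<Longrightarrow> X \<noteq> {} \<Longrightarrow> \<exists>v\<in>X. card (neighbors G v \<inter> X) \<le> d"
  shows "star_chromatic_number G \<le> K ^ (d * d) * Suc (d + d * d)"
proof -
  have "\<exists>v\<in>X. card {u\<in>X. u \<noteq> v \<and> (v, u) \<in> parcs G} \<le> d"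
    if X: "X \<subseteq> pverts G" "X \<noteq> {}" for X
  proof -
    obtain v where v: "v \<in> X" "card (neighbors G v \<inter> X) \<le> d" using deg[OF X] by blast
    have "card {u\<in>X. u \<noteq> v \<and> (v, u) \<in> parcs G} \<le> card (neighbors G v \<inter> X)"
      using finite_neighbors by (intro card_mono) (auto simp: neighbors_def)
    then show ?thesis using v by force
  qed
  from degenerate_ordering[OF pair_finite_verts this]
  obtain r :: "'a \<Rightarrow> nat" where r: "inj_on r (pverts G)"
    "\<forall>v\<in>pverts G. card {u\<in>pverts G. (v, u) \<in> parcs G \<and> r u < r v} \<le> d"
    by blast
  define out where "out v = {u\<in>pverts G. (v, u) \<in> parcs G \<and> r u < r v}" for v
  have out_V: "out v \<subseteq> pverts G" for v by (auto simp: out_def)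
  have fin_out: "finite (out v)" for v using pair_finite_verts by (simp add: out_def)
  have card_out: "card (out v) \<le> d" if "v \<in> pverts G" for v using r(2) that by (simp add: out_def)
  have out_cases: "v \<in> out u \<or> u \<in> out v" if "(u, v) \<in> parcs G" for u v
    using that r(1) arcs_symmetric[OF that] in_arcsD1[OF that] in_arcsD2[OF that] no_loops'[OF that]
    by (auto simp: out_def inj_on_def) (metis linorder_neqE_nat)
  have "neighborhood_system G out" by (auto simp: neighborhood_system_def out_def neighbors_def)
  from bounded_system_coloring[OF K this card_out]
  obtain c1 :: "'a \<Rightarrow> nat" where c1: "sigma_coloring G out c1" "c1 ` pverts G \<subseteq> {..<K ^ (d * d)}"
    by blast
  define E where "E u v \<longleftrightarrow> (u, v) \<in> parcs G \<or> (\<exists>y. y \<in> out u \<and> v \<in> out y) \<or> (\<exists>y. y \<in> out v \<and> u \<in> out y)"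
    for u v
  have "\<exists>c :: 'a \<Rightarrow> nat. c ` pverts G \<subseteq> {..d + d * d} \<and>
    (\<forall>u\<in>pverts G. \<forall>v\<in>pverts G. u \<noteq> v \<and> E u v \<longrightarrow> c u \<noteq> c v)"
  proof (rule degenerate_coloring[OF pair_finite_verts])
    show "E v u" if "E u v" for u v using that arcs_symmetric by (auto simp: E_def)
  next
    fix X assume X: "X \<subseteq> pverts G" "X \<noteq> {}"
    have "finite X" using X pair_finite_verts finite_subset by blast
    then obtain v where v: "v \<in> X" "\<And>u. u \<in> X \<Longrightarrow> r u \<le> r v"
      using X(2) finite_has_maximizer[of X r] by blast
    have vV: "v \<in> pverts G" using v X by auto
    \<comment> \<open>As \<open>v\<close> comes last in \<open>X\<close>, it is neither an
      out-neighbour of \<open>u\<close> nor the end of a directed path of length two from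
      \<open>u\<close>. This leaves at most \<open>d + d * d\<close> conflicts.\<close>
    have "{u\<in>X. u \<noteq> v \<and> E v u} \<subseteq> out v \<union> (\<Union>y\<in>out v. out y)"
    proof
      fix u assume u: "u \<in> {u\<in>X. u \<noteq> v \<and> E v u}"
      then have "r u \<le> r v" using v by simp
      then have "v \<notin> out u" "\<not> (y \<in> out u \<and> v \<in> out y)" for y
        by (auto simp: out_def)
      then show "u \<in> out v \<union> (\<Union>y\<in>out v. out y)" using u out_cases[of v u] by (auto simp: E_def)
    qed
    then have "card {u\<in>X. u \<noteq> v \<and> E v u} \<le> card (out v \<union> (\<Union>y\<in>out v. out y))"
      using fin_out by (intro card_mono) auto
    also have "\<dots> \<le> card (out v) + card (\<Union>y\<in>out v. out y)" by (rule card_Un_le)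
    also have "card (\<Union>y\<in>out v. out y) \<le> (\<Sum>y\<in>out v. card (out y))"
      using fin_out by (rule card_UN_le)
    also have "\<dots> \<le> card (out v) * d"
      using sum_bounded_above[of "out v" "\<lambda>y. card (out y)" d] card_out out_V by auto
    also have "card (out v) + card (out v) * d \<le> d + d * d"
      using card_out[OF vV] by (intro add_mono mult_right_mono) auto
    finally show "\<exists>v\<in>X. card {u\<in>X. u \<noteq> v \<and> E v u} \<le> d + d * d" using v(1) by auto
  qed
  then obtain c2 :: "'a \<Rightarrow> nat" where c2: "c2 ` pverts G \<subseteq> {..d + d * d}"
    "\<And>u v. u \<in> pverts G \<Longrightarrow> v \<in> pverts G \<Longrightarrow> u \<noteq> v \<Longrightarrow> E u v \<Longrightarrow> c2 u \<noteq> c2 v"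
    by blast
  have "(\<lambda>x. (c1 x, c2 x)) ` pverts G \<subseteq> {..<K ^ (d * d)} \<times> {..d + d * d}"
    using c1(2) c2(1) by auto
  then have "card ((\<lambda>x. (c1 x, c2 x)) ` pverts G) \<le> K ^ (d * d) * Suc (d + d * d)"
    using card_mono[of "{..<K ^ (d * d)} \<times> {..d + d * d}" "(\<lambda>x. (c1 x, c2 x)) ` pverts G"]
    by (simp add: card_cartesian_product)
  then obtain c :: "'a \<Rightarrow> nat" where c: "c ` pverts G \<subseteq> {..<K ^ (d * d) * Suc (d + d * d)}"
    "\<forall>u\<in>pverts G. \<forall>v\<in>pverts G. c u = c v \<longleftrightarrow> (c1 u, c2 u) = (c1 v, c2 v)"
    using nat_recoloring[OF pair_finite_verts] by blast
  have c1': "c1 u \<noteq> c1 v" if "u \<in> out w" "v \<in> out w" "u \<noteq> v" "w \<in> pverts G" for u v w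
    using c1(1) that unfolding sigma_coloring_def by blast
  have "star_coloring G c"
    unfolding star_coloring_iff_no_bicolored_path
  proof (intro conjI allI impI)
    show "proper_coloring G c"
      using c(2) c2(2) no_loops' in_arcsD1 in_arcsD2 unfolding proper_coloring_def E_def by auto
  next
    fix x y z w
    assume *: "(x, y) \<in> parcs G \<and> (y, z) \<in> parcs G \<and> (z, w) \<in> parcs G \<and> c x = c z \<and> c y = c w"
    then have V: "x \<in> pverts G" "y \<in> pverts G" "z \<in> pverts G" "w \<in> pverts G"
      by (auto dest: wellformed')
    then have eq: "c1 x = c1 z" "c2 x = c2 z" "c1 y = c1 w" "c2 y = c2 w" using * c(2) by auto
    show "x = z \<or> y = w"
    \<comment> \<open>The middle edge decides. If it points to \<open>z\<close>, then either
      \<open>x\<close> and \<open>z\<close> are both out-neighbours of \<open>y\<close>, where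
      \<open>c1\<close> separates them, or the path runs from \<open>x\<close> through
      \<open>y\<close> to \<open>z\<close>, where \<open>c2\<close> does; hence
      \<open>x = z\<close>. The other case is its mirror image and gives
      \<open>y = w\<close>.\<close>
    proof (cases "z \<in> out y")
      case True
      then show ?thesis
        using out_cases[of x y] * V eq c1'[of x y z] c2(2)[of x z] by (auto simp: E_def)
    next
      case False
      then have "y \<in> out z" using out_cases[of y z] * by auto
      then show ?thesis
        using out_cases[of z w] * V eq c1'[of y z w] c2(2)[of y w] by (auto simp: E_def)
    qed
  qed
  moreover have "card (c ` pverts G) \<le> K ^ (d * d) * Suc (d + d * d)"
    using card_mono[OF _ c(1)] by simp
  ultimately show ?thesis by (rule star_chromatic_number_le)
qed

text \<open>A vertex \<open>v\<close> and a colour \<open>b\<close> determine the vertex \<open>w\<close> of colour \<open>b\<close> for which \<open>S w\<close> contains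
  \<open>v\<close> and a further vertex of the colour of \<open>v\<close>: it is the centre of a star having \<open>v\<close> as a leaf.\<close>

lemma chi_sigma_le_of_star_coloring:
  assumes c: "star_coloring G c" and S: "neighborhood_system G S"
  defines "k \<equiv> card (c ` pverts G)"
  shows "chi_sigma G S \<le> k * Suc (k * rho_sigma G S)"
proof -
  have no_path: "x = z \<or> y = w"
    if "(x, y) \<in> parcs G" "(y, z) \<in> parcs G" "(z, w) \<in> parcs G" "c x = c z" "c y = c w" for x y z w
    using c that unfolding star_coloring_iff_no_bicolored_path by blast
  have S_arc: "(w, u) \<in> parcs G" "(u, w) \<in> parcs G" if "w \<in> pverts G" "u \<in> S w" for u w
    using S that arcs_symmetric[of w u] by (auto simp: neighborhood_system_def neighbors_def)
  \<comment> \<open>Only vertices of equal colour under \<open>c\<close> need a further distinction,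
    since the final colouring keeps \<open>c\<close> as one component.\<close>
  define E where "E u v \<longleftrightarrow> c u = c v \<and> (\<exists>w\<in>pverts G. u \<in> S w \<and> v \<in> S w)" for u v
  have card_conflicts: "card {u\<in>pverts G. u \<noteq> v \<and> E v u} \<le> k * rho_sigma G S" for v
  proof -
    define Q where "Q b = {u. u \<noteq> v \<and> c v = c u \<and> (\<exists>w\<in>pverts G. c w = b \<and> v \<in> S w \<and> u \<in> S w)}" for b
    have Q: "finite (Q b) \<and> card (Q b) \<le> rho_sigma G S" for b
    proof (cases "Q b = {}")
      case False
      then obtain u w where u: "u \<noteq> v" "c v = c u" "w \<in> pverts G" "c w = b" "v \<in> S w" "u \<in> S w"
        by (auto simp: Q_def)
      have "x \<in> S w" if x: "x \<in> Q b" for x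
      proof -
        obtain w' where w': "w' \<in> pverts G" "c w' = b" "v \<in> S w'" "x \<in> S w'"
          using x by (auto simp: Q_def)
        \<comment> \<open>Otherwise \<open>w'\<close>, \<open>v\<close>, \<open>w\<close>,
          \<open>u\<close> would be a bicoloured path: \<open>w'\<close> and \<open>w\<close> have
          colour \<open>b\<close>, and \<open>v\<close> and \<open>u\<close> are distinct vertices
          of equal colour.\<close>
        then have "w' = w" using no_path[of w' v w u] S_arc u by auto
        then show ?thesis using w' by simp
      qed
      then have "Q b \<subseteq> S w" by blast
      moreover have "finite (S w)"
        using S u(3) finite_subset finite_neighbors unfolding neighborhood_system_def by blast
      ultimately show ?thesis
        using card_mono[of "S w" "Q b"] card_le_rho_sigma[OF u(3), of S] finite_subset by fastforce
    qed simp
    have fin_c: "finite (c ` pverts G)" using pair_finite_verts by simp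
    have "card {u\<in>pverts G. u \<noteq> v \<and> E v u} \<le> card (\<Union>b\<in>c ` pverts G. Q b)"
      using Q fin_c by (intro card_mono) (auto simp: E_def Q_def)
    also have "\<dots> \<le> (\<Sum>b\<in>c ` pverts G. card (Q b))" using fin_c by (rule card_UN_le)
    also have "\<dots> \<le> k * rho_sigma G S"
      using sum_bounded_above[of "c ` pverts G" "\<lambda>b. card (Q b)" "rho_sigma G S"] Q by (simp add: k_def)
    finally show ?thesis .
  qed
  have "\<exists>c' :: 'a \<Rightarrow> nat. c' ` pverts G \<subseteq> {..k * rho_sigma G S} \<and>
    (\<forall>u\<in>pverts G. \<forall>v\<in>pverts G. u \<noteq> v \<and> E u v \<longrightarrow> c' u \<noteq> c' v)"
  proof (rule degenerate_coloring[OF pair_finite_verts])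
    show "E v u" if "E u v" for u v using that by (auto simp: E_def)
  next
    fix X assume X: "X \<subseteq> pverts G" "X \<noteq> {}"
    then obtain v where v: "v \<in> X" by blast
    have "card {u\<in>X. u \<noteq> v \<and> E v u} \<le> card {u\<in>pverts G. u \<noteq> v \<and> E v u}"
      using X pair_finite_verts by (intro card_mono) auto
    then show "\<exists>v\<in>X. card {u\<in>X. u \<noteq> v \<and> E v u} \<le> k * rho_sigma G S"
      using v card_conflicts[of v] by (meson order_trans)
  qed
  then obtain c' :: "'a \<Rightarrow> nat" where c': "c' ` pverts G \<subseteq> {..k * rho_sigma G S}"
    "\<And>u v. u \<in> pverts G \<Longrightarrow> v \<in> pverts G \<Longrightarrow> u \<noteq> v \<Longrightarrow> E u v \<Longrightarrow> c' u \<noteq> c' v"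
    by blast
  have "(\<lambda>x. (c x, c' x)) ` pverts G \<subseteq> c ` pverts G \<times> {..k * rho_sigma G S}" using c'(1) by auto
  then have "card ((\<lambda>x. (c x, c' x)) ` pverts G) \<le> k * Suc (k * rho_sigma G S)"
    using card_mono[of "c ` pverts G \<times> {..k * rho_sigma G S}" "(\<lambda>x. (c x, c' x)) ` pverts G"]
      pair_finite_verts by (simp add: k_def card_cartesian_product)
  then obtain h :: "'a \<Rightarrow> nat" where h: "h ` pverts G \<subseteq> {..<k * Suc (k * rho_sigma G S)}"
    "\<forall>u\<in>pverts G. \<forall>v\<in>pverts G. h u = h v \<longleftrightarrow> (c u, c' u) = (c v, c' v)"
    using nat_recoloring[OF pair_finite_verts] by blast
  have "sigma_coloring G S h"
    unfolding sigma_coloring_def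
  proof (intro ballI impI)
    fix w u v assume w: "w \<in> pverts G" "u \<in> S w" "v \<in> S w" "u \<noteq> v"
    then have "u \<in> pverts G" "v \<in> pverts G" using S_arc in_arcsD1 by blast+
    then show "h u \<noteq> h v" using h(2) c'(2)[of u v] w by (auto simp: E_def)
  qed
  then show ?thesis using card_mono[OF _ h(1)] by (intro chi_sigma_le) auto
qed

text \<open>Systems with \<open>rho_sigma\<close> below 2 escape the hypothesis on
  \<open>rho_sigma G S = 2\<close>, but one colour is enough for them, and \<open>0 < K\<close>
  provides it.\<close>

lemma pair_systems_colorableI:
  assumes "0 < K"
    and K: "\<And>S. neighborhood_system G S \<Longrightarrow> rho_sigma G S = 2 \<Longrightarrow> chi_sigma G S \<le> K"
  shows "pair_systems_colorable G K"
  unfolding pair_systems_colorable_def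
proof (intro allI impI)
  fix S assume S: "neighborhood_system G S \<and> (\<forall>v\<in>pverts G. card (S v) \<le> 2)"
  then have "rho_sigma G S \<le> 2" by (intro rho_sigma_le) auto
  then have "chi_sigma G S \<le> K"
    using S K[of S] chi_sigma_le_1[of S] assms(1) by (cases "rho_sigma G S = 2") auto
  then obtain c where c: "sigma_coloring G S c" "card (c ` pverts G) \<le> K"
    using sigma_coloring_of_chi_sigma[of S] S by auto
  obtain c' :: "'a \<Rightarrow> nat" where c': "c' ` pverts G \<subseteq> {..<K}"
    "\<forall>u\<in>pverts G. \<forall>v\<in>pverts G. c' u = c' v \<longleftrightarrow> c u = c v"
    using nat_recoloring[OF pair_finite_verts c(2)] by blast
  have "sigma_coloring G S c'"
    unfolding sigma_coloring_def
  proof (intro ballI impI)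
    fix w u v assume w: "w \<in> pverts G" "u \<in> S w" "v \<in> S w" "u \<noteq> v"
    then have "u \<in> pverts G" "v \<in> pverts G"
      using S by (auto simp: neighborhood_system_def neighbors_def dest: wellformed')
    then show "c' u \<noteq> c' v" using c'(2) c(1) w by (auto simp: sigma_coloring_def)
  qed
  then show "\<exists>c. sigma_coloring G S c \<and> c ` pverts G \<subseteq> {..<K}" using c'(1) by blast
qed

end

section \<open>The implications between the four conditions\<close>

lemma linearly_sigma_bounded_imp_sigma_bounded:
  assumes F: "\<And>G. G \<in> F \<Longrightarrow> pair_graph G" and "linearly_sigma_bounded F"
  shows "sigma_bounded F"
proof -
  obtain B where B: "real (chi_sigma G S) / real (rho_sigma G S) \<le> B"
    if "G \<in> F" "neighborhood_system G S" "1 \<le> rho_sigma G S" for G S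
    using assms(2) unfolding linearly_sigma_bounded_def bdd_above_def by blast
  \<comment> \<open>The maximum with 1 covers systems with \<open>rho_sigma G S = 0\<close>, for
    which the ratio is not controlled.\<close>
  have "chi_sigma G S \<le> max 1 (nat \<lceil>B * real (rho_sigma G S)\<rceil>)"
    if "G \<in> F" "neighborhood_system G S" for G S
  proof (cases "1 \<le> rho_sigma G S")
    case True
    then have "real (chi_sigma G S) \<le> B * real (rho_sigma G S)"
      using B[OF that] by (simp add: field_simps)
    then show ?thesis by linarith
  next
    case False
    then show ?thesis using pair_graph.chi_sigma_le_1[OF F[OF that(1)] that(2)] by auto
  qed
  then show ?thesis unfolding sigma_bounded_def by (intro exI[of _ "\<lambda>n. max 1 (nat \<lceil>B * real n\<rceil>)"]) blast
qed

lemma sigma_bounded_imp_bounded_pair_systems: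
  fixes F :: "'a pair_pre_digraph set"
  assumes "sigma_bounded F"
  shows "bdd_above {chi_sigma G S | G S. G \<in> F \<and> neighborhood_system G S \<and> rho_sigma G S = 2}"
proof -
  obtain f where f: "\<forall>G\<in>F. \<forall>S. neighborhood_system G S \<longrightarrow> chi_sigma G S \<le> f (rho_sigma G S)"
    using assms unfolding sigma_bounded_def by blast
  show ?thesis
  proof (rule bdd_aboveI)
    fix x assume "x \<in> {chi_sigma G S | G S. G \<in> F \<and> neighborhood_system G S \<and> rho_sigma G S = 2}"
    then obtain G S where "x = chi_sigma G S" "G \<in> F" "neighborhood_system G S" "rho_sigma G S = 2"
      by blast
    then show "x \<le> f 2" using f by metis
  qed
qed

lemma bounded_pair_systems_imp_bounded_star_chromatic_number:
  fixes F :: "'a pair_pre_digraph set"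
  assumes F: "\<And>G. G \<in> F \<Longrightarrow> pair_graph G"
    and bdd: "bdd_above {chi_sigma G S | G S. G \<in> F \<and> neighborhood_system G S \<and> rho_sigma G S = 2}"
  shows "bdd_above (star_chromatic_number ` F)"
proof -
  obtain B where B: "chi_sigma G S \<le> B"
    if "G \<in> F" "neighborhood_system G S" "rho_sigma G S = 2" for G S
    using bdd unfolding bdd_above_def by blast
  \<comment> \<open>The palette has size \<open>Suc B\<close> because the degeneracy argument
    requires a positive number of colours and \<open>B\<close> may be 0.\<close>
  from pair_systems_colorable_degenerate[OF zero_less_Suc[of B]]
  obtain D where D: "\<forall>G :: 'a pair_pre_digraph. pair_graph G \<longrightarrow> pair_systems_colorable G (Suc B) \<longrightarrow>
    (\<forall>X\<subseteq>pverts G. X \<noteq> {} \<longrightarrow> (\<exists>v\<in>X. card (neighbors G v \<inter> X) < D))"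
    by (rule exE)
  show ?thesis
  proof (intro bdd_aboveI2)
    fix G assume G: "G \<in> F"
    then interpret pair_graph G by (rule F)
    have K: "pair_systems_colorable G (Suc B)"
      using B[OF G] by (intro pair_systems_colorableI) (auto intro: le_SucI)
    show "star_chromatic_number G \<le> Suc B ^ (D * D) * Suc (D + D * D)"
    proof (rule star_chromatic_number_le_of_degenerate[OF K])
      fix X assume "X \<subseteq> pverts G" "X \<noteq> {}"
      then show "\<exists>v\<in>X. card (neighbors G v \<inter> X) \<le> D"
        using D[rule_format, OF F[OF G] K, of X] less_imp_le by blast
    qed
  qed
qed

lemma bounded_star_chromatic_number_imp_linearly_sigma_bounded:
  assumes F: "\<And>G. G \<in> F \<Longrightarrow> pair_graph G" and "bdd_above (star_chromatic_number ` F)"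
  shows "linearly_sigma_bounded F"
proof -
  obtain k where k: "\<And>G. G \<in> F \<Longrightarrow> star_chromatic_number G \<le> k"
    using assms(2) unfolding bdd_above_def by blast
  have "real (chi_sigma G S) / real (rho_sigma G S) \<le> real (k * Suc k)"
    if G: "G \<in> F" and S: "neighborhood_system G S" and \<rho>: "1 \<le> rho_sigma G S" for G S
  proof -
    interpret pair_graph G using F[OF G] .
    obtain c where c: "star_coloring G c" "card (c ` pverts G) \<le> k"
      using star_coloring_of_star_chromatic_number k[OF G] by metis
    have "chi_sigma G S \<le> card (c ` pverts G) * Suc (card (c ` pverts G) * rho_sigma G S)"
      using chi_sigma_le_of_star_coloring[OF c(1) S] .
    also have "\<dots> \<le> k * Suc (k * rho_sigma G S)"
      using c(2) by (intro mult_mono) auto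
    \<comment> \<open>The additive 1 is absorbed into \<open>rho_sigma G S \<ge> 1\<close>, which
      makes the bound linear.\<close>
    also have "\<dots> \<le> k * (Suc k * rho_sigma G S)" using \<rho> by (intro mult_left_mono) auto
    also have "\<dots> = k * Suc k * rho_sigma G S" by (simp only: mult.assoc)
    finally have "real (chi_sigma G S) \<le> real (k * Suc k) * real (rho_sigma G S)"
      by (simp only: of_nat_mult[symmetric] of_nat_le_iff)
    then show ?thesis using \<rho> by (simp add: pos_divide_le_eq)
  qed
  then show ?thesis unfolding linearly_sigma_bounded_def bdd_above_def by blast
qed

theorem theorem1:
  fixes F :: "'a pair_pre_digraph set"
  assumes "\<And>G. G \<in> F \<Longrightarrow> pair_graph G"
  shows "(linearly_sigma_bounded F \<longleftrightarrow> sigma_bounded F)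
    \<and> (sigma_bounded F \<longleftrightarrow>
        bdd_above {chi_sigma G S | G S. G \<in> F \<and> neighborhood_system G S \<and> rho_sigma G S = 2})
    \<and> (bdd_above {chi_sigma G S | G S. G \<in> F \<and> neighborhood_system G S \<and> rho_sigma G S = 2}
        \<longleftrightarrow> bdd_above (star_chromatic_number ` F))"
proof -
  let ?P = "bdd_above {chi_sigma G S | G S. G \<in> F \<and> neighborhood_system G S \<and> rho_sigma G S = 2}"
  have "sigma_bounded F \<Longrightarrow> ?P"
    by (rule sigma_bounded_imp_bounded_pair_systems)
  moreover have "linearly_sigma_bounded F \<Longrightarrow> sigma_bounded F"
    using assms by (rule linearly_sigma_bounded_imp_sigma_bounded)
  moreover have "?P \<Longrightarrow> bdd_above (star_chromatic_number ` F)"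
    using assms by (rule bounded_pair_systems_imp_bounded_star_chromatic_number)
  moreover have "bdd_above (star_chromatic_number ` F) \<Longrightarrow> linearly_sigma_bounded F"
    using assms by (rule bounded_star_chromatic_number_imp_linearly_sigma_bounded)
  ultimately show ?thesis by argo
qed

end
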